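(* The following equalities hold: (a) $\displaystyle\prod_{n\ge0}\left(\frac{2n+1}{2n+2}\right)^{(-1)^{t_n}}=\frac{\sqrt2}{2}$; (b) $\displaystyle\prod_{n\ge0}\left(\frac{4n+1}{4n+3}\right)^{(-1)^{t_n}}=\frac12$; (c) $\displaystyle\prod_{n\ge1}\left(\frac{(2n-1)(4n+1)}{(2n+1)(4n-1)}\right)^{(-1)^{t_n}}=2$; (d) $\displaystyle\prod_{n\ge0}\left(\frac{(n+1)(2n+1)}{(n+2)(2n+3)}\right)^{(-1)^{t_n}}=\frac12$; (e) $\displaystyle\prod_{n\ge0}\left(\frac{(2n+2)(4n+3)}{(2n+3)(4n+5)}\right)^{(-1)^{t_n}}=\frac{\sqrt2}{2}$; (f) $\displaystyle\prod_{n\ge0}\left(\frac{(n+1)(4n+5)}{(n+2)(4n+3)}\right)^{(-1)^{t_n}}=1$; (g) $\displaystyle\prod_{n\ge0}\left(\frac{(n+1)(2n+2)}{(n+2)(2n+3)}\right)^{(-1)^{t_n}}=\frac{\sqrt2}{2}$; (h) $\displaystyle\prod_{n\ge0}\left(\frac{(n+1)(4n+5)}{(n+2)(4n+1)}\right)^{(-1)^{t_n}}=2$; (i) $\displaystyle\prod_{n\ge0}\left(\frac{(2n+2)(4n+1)}{(2n+3)(4n+5)}\right)^{(-1)^{t_n}}=\frac{\sqrt2}{4}$; (j) $\displaystyle\prod_{n\ge0}\left(\frac{(2n+1)(4n+1)}{(2n+3)(4n+5)}\right)^{(-1)^{t_n}}=\frac14$; (k) $\displaystyle\prod_{n\ge0}\left(\frac{(4n+1)(8n+7)}{(4n+2)(8n+3)}\right)^{(-1)^{t_n}}=1$;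 (l) $\displaystyle\prod_{n\ge0}\left(\frac{(8n+1)(8n+7)}{(8n+3)(8n+5)}\right)^{(-1)^{t_n}}=\frac12$.
   Context: For an integer $n\ge 0$, $t_n\in\{0,1\}$ denotes the sum modulo $2$ of the binary digits of $n$ (the Thue-Morse sequence $0,1,1,0,1,0,0,1,\ldots$); equivalently $t_0=0$, $t_{2n}=t_n$, $t_{2n+1}=1-t_n$. Infinite products are limits of the partial products taken in increasing order of $n$. Note that the product in (c) starts at $n=1$, all the others at $n=0$. *)

theory Defs
  imports "HOL-Analysis.Analysis"
begin

text \<open>The summand is the binary digit of \<open>n\<close> at position \<open>k\<close>; since \<open>n < 2 ^ n\<close>, all digits at
  positions \<open>k \<ge> n\<close> are zero, so the sum runs over all of them.\<close>

definition thue_morse :: "nat \<Rightarrow> nat" where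
  "thue_morse n = (\<Sum>k<n. n div 2 ^ k mod 2) mod 2"

lemma binary_digit_sum_extend:
  fixes n m :: nat
  assumes "n \<le> m"
  shows "(\<Sum>k<m. n div 2 ^ k mod 2) = (\<Sum>k<n. n div 2 ^ k mod 2)"
proof (rule sum.mono_neutral_right)
  show "\<forall>k\<in>{..<m} - {..<n}. n div 2 ^ k mod 2 = 0"
  proof
    fix k assume "k \<in> {..<m} - {..<n}"
    then have "n < 2 ^ k"
      using order.strict_trans1[OF _ less_exp[of k]] by simp
    then show "n div 2 ^ k mod 2 = 0" by simp
  qed
qed (use assms in auto)

lemma thue_morse_0: "thue_morse 0 = 0"
  by (simp add: thue_morse_def)

lemma thue_morse_shift:
  assumes "b < 2"
  shows "thue_morse (2 * n + b) = (thue_morse n + b) mod 2"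
proof -
  let ?m = "2 * n + b"
  have "(\<Sum>k<?m. ?m div 2 ^ k mod 2) = (\<Sum>k<Suc ?m. ?m div 2 ^ k mod 2)"
    by (rule binary_digit_sum_extend[symmetric]) simp
  also have "\<dots> = b + (\<Sum>k<?m. ?m div 2 ^ Suc k mod 2)"
    using assms by (subst sum.lessThan_Suc_shift) simp
  also have "\<And>k. ?m div 2 ^ Suc k = n div 2 ^ k"
    using assms by (simp add: div_mult2_eq)
  then have "(\<Sum>k<?m. ?m div 2 ^ Suc k mod 2) = (\<Sum>k<?m. n div 2 ^ k mod 2)"
    by simp
  also have "\<dots> = (\<Sum>k<n. n div 2 ^ k mod 2)"
    by (rule binary_digit_sum_extend) simp
  finally show ?thesis
    unfolding thue_morse_def by (simp add: mod_add_left_eq add.commute mod_add_right_eq)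
qed

lemma thue_morse_even: "thue_morse (2 * n) = thue_morse n"
  using thue_morse_shift[of 0 n] by (simp add: thue_morse_def)

lemma thue_morse_odd: "thue_morse (2 * n + 1) = 1 - thue_morse n"
proof -
  have "thue_morse n < 2" by (simp add: thue_morse_def)
  then have "thue_morse n = 0 \<or> thue_morse n = 1" by linarith
  then show ?thesis
    using thue_morse_shift[of 1 n] by auto
qed

end

theory Submission
  imports Defs "HOL-Real_Asymp.Real_Asymp"
begin

text \<open>Taking logarithms, every product becomes a sum of values of
  \<open>h a = (\<Sum>n. (-1) ^ t\<^sub>n * (ln (n + a) - ln (n + 1)))\<close>.  Splitting this series into even and
  odd \<open>n\<close> gives \<open>h (a / 2) - h ((a + 1) / 2) = h a + h (1 / 2)\<close>, and the degenerate case \<open>a = 0\<close>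
  of the same splitting gives \<open>h (1 / 2) = - ln 2 / 2\<close>.  All twelve evaluations are linear
  consequences of these relations.\<close>

section \<open>Thue-Morse signs and the pairing of consecutive terms\<close>

definition tm_sign :: "nat \<Rightarrow> real" where
  "tm_sign n = (- 1) ^ thue_morse n"

lemma tm_sign_0: "tm_sign 0 = 1"
  by (simp add: tm_sign_def thue_morse_0)

lemma thue_morse_cases: "thue_morse n = 0 \<or> thue_morse n = 1"
  unfolding thue_morse_def by linarith

lemma tm_sign_double: "tm_sign (2 * n) = tm_sign n"
  by (simp add: tm_sign_def thue_morse_even)

lemma tm_sign_Suc_double: "tm_sign (Suc (2 * n)) = - tm_sign n"
  using thue_morse_cases[of n] thue_morse_odd[of n] by (auto simp: tm_sign_def)

lemma abs_tm_sign: "\<bar>tm_sign n\<bar> = 1"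
  by (simp add: tm_sign_def power_abs)

lemma powi_tm_sign:
  fixes x :: real
  assumes "x > 0"
  shows "x powi ((- 1) ^ thue_morse n) = exp (tm_sign n * ln x)"
  using thue_morse_cases[of n] assms
  by (auto simp: tm_sign_def exp_minus power_int_minus)

lemma sum_tm_sign_double:
  "(\<Sum>n<2 * N. tm_sign n * u n) = (\<Sum>n<N. tm_sign n * (u (2 * n) - u (Suc (2 * n))))"
  by (induction N) (simp_all add: tm_sign_double tm_sign_Suc_double right_diff_distrib)

lemma tendsto_even_odd:
  fixes f :: "nat \<Rightarrow> 'a::topological_space"
  assumes "(\<lambda>n. f (2 * n)) \<longlonglongrightarrow> L" "(\<lambda>n. f (Suc (2 * n))) \<longlonglongrightarrow> L"
  shows "f \<longlonglongrightarrow> L"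
proof (rule topological_tendstoI)
  fix S assume S: "open S" "L \<in> S"
  obtain M where M: "\<And>n. n \<ge> M \<Longrightarrow> f (2 * n) \<in> S"
    using topological_tendstoD[OF assms(1) S] by (auto simp: eventually_sequentially)
  obtain N where N: "\<And>n. n \<ge> N \<Longrightarrow> f (Suc (2 * n)) \<in> S"
    using topological_tendstoD[OF assms(2) S] by (auto simp: eventually_sequentially)
  have "f n \<in> S" if "n \<ge> 2 * (M + N) + 1" for n
    using that M[of "n div 2"] N[of "n div 2"]
    by (cases "even n") (auto elim!: evenE oddE)
  then show "\<forall>\<^sub>F n in sequentially. f n \<in> S"
    unfolding eventually_sequentially by blast
qed

text \<open>The signs at \<open>2 * n\<close> and \<open>Suc (2 * n)\<close> are opposite, so
  pairing these terms reproduces a series with the same signs. The partial sums of the paired series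
  are those of even length of the original one.\<close>

lemma tm_sign_sums_iff:
  fixes u :: "nat \<Rightarrow> real"
  assumes "u \<longlonglongrightarrow> 0"
  shows "(\<lambda>n. tm_sign n * u n) sums S \<longleftrightarrow>
    (\<lambda>n. tm_sign n * (u (2 * n) - u (Suc (2 * n)))) sums S"
proof
  assume "(\<lambda>n. tm_sign n * u n) sums S"
  then have "((\<lambda>N. \<Sum>n<N. tm_sign n * u n) \<circ> (\<lambda>N. 2 * N)) \<longlonglongrightarrow> S"
    unfolding sums_def by (rule LIMSEQ_subseq_LIMSEQ) (auto simp: strict_mono_def)
  then show "(\<lambda>n. tm_sign n * (u (2 * n) - u (Suc (2 * n)))) sums S"
    by (simp add: sums_def o_def sum_tm_sign_double)
next
  assume "(\<lambda>n. tm_sign n * (u (2 * n) - u (Suc (2 * n)))) sums S"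
  then have even: "(\<lambda>N. \<Sum>n<2 * N. tm_sign n * u n) \<longlonglongrightarrow> S"
    by (simp add: sums_def sum_tm_sign_double)
  have "(\<lambda>n. \<bar>tm_sign n * u n\<bar>) \<longlonglongrightarrow> 0"
    using tendsto_rabs[OF assms] by (simp add: abs_mult abs_tm_sign)
  then have "(\<lambda>n. tm_sign n * u n) \<longlonglongrightarrow> 0"
    by (rule tendsto_rabs_zero_cancel)
  then have "((\<lambda>n. tm_sign n * u n) \<circ> (\<lambda>n. 2 * n)) \<longlonglongrightarrow> 0"
    by (rule LIMSEQ_subseq_LIMSEQ) (auto simp: strict_mono_def)
  \<comment> \<open>A partial sum of odd length exceeds one of even length by the single term at
    \<open>2 * N\<close>, which tends to 0.\<close>
  from tendsto_add[OF even this]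
  have "(\<lambda>N. \<Sum>n<Suc (2 * N). tm_sign n * u n) \<longlonglongrightarrow> S"
    by (simp add: o_def)
  with even show "(\<lambda>n. tm_sign n * u n) sums S"
    unfolding sums_def by (rule tendsto_even_odd)
qed

text \<open>Since \<open>ln (- x) = ln x\<close> and \<open>ln 0 = 0\<close>, this series makes sense for every real \<open>a\<close>; negative
  \<open>a\<close> occurs in (c), and \<open>a = 0\<close> in the evaluation of \<open>tm_log (1 / 2)\<close>.\<close>

definition tm_log :: "real \<Rightarrow> real" where
  "tm_log a = (\<Sum>n. tm_sign n * (ln (real n + a) - ln (real n + 1)))"

section \<open>Convergence of the logarithmic series\<close>

lemma tendsto_ln_diff: "(\<lambda>n. ln (real n + a) - ln (real n + b)) \<longlonglongrightarrow> 0"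
  by real_asymp

lemma tm_log_sums:
  "(\<lambda>n. tm_sign n * (ln (real n + a) - ln (real n + 1))) sums tm_log a"
proof -
  let ?u = "\<lambda>n. ln (real n + a) - ln (real n + 1)"
  let ?v = "\<lambda>n. ?u (2 * n) - ?u (Suc (2 * n))"
  have "?v \<in> O(\<lambda>n. 1 / real n ^ 2)"
    by (simp, real_asymp)
  then have "(\<lambda>n. tm_sign n * ?v n) \<in> O(\<lambda>n. 1 / real n ^ 2)"
    by (simp add: bigo_def abs_mult abs_tm_sign)
  moreover have "summable (\<lambda>n. norm (1 / real n ^ 2))"
    using inverse_power_summable[of 2, where ?'a = real] by (simp add: field_simps)
  ultimately have "summable (\<lambda>n. tm_sign n * ?v n)"
    by (rule summable_comparison_test_bigo[rotated])
  then have "summable (\<lambda>n. tm_sign n * ?u n)"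
    using tm_sign_sums_iff[OF tendsto_ln_diff[of a 1]] by (auto simp: summable_def)
  then show ?thesis
    unfolding tm_log_def by (rule summable_sums)
qed

lemma tm_log_diff_sums:
  "(\<lambda>n. tm_sign n * (ln (real n + a) - ln (real n + b))) sums (tm_log a - tm_log b)"
  using sums_diff[OF tm_log_sums[of a] tm_log_sums[of b]] by (simp add: algebra_simps)

lemma tm_log_1: "tm_log 1 = 0"
  by (simp add: tm_log_def)

section \<open>The functional equation of \<open>tm_log\<close>\<close>

lemma tm_log_split_sums:
  "(\<lambda>n. tm_sign n * (ln (2 * real n + a) - ln (2 * real n + 1)
      - ln (2 * real n + 1 + a) + ln (2 * real n + 2))) sums tm_log a"
  using tm_log_sums[of a] unfolding tm_sign_sums_iff[OF tendsto_ln_diff[of a 1]]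
  by (simp add: algebra_simps)

lemma ln_double_add:
  assumes "2 * real n + a \<noteq> 0"
  shows "ln (2 * real n + a) = ln 2 + ln (real n + a / 2)"
proof -
  have "ln (2 * real n + a) = ln (2 * (real n + a / 2))"
    by (simp add: algebra_simps)
  also have "\<dots> = ln 2 + ln (real n + a / 2)"
    using assms by (subst ln_mult) auto
  finally show ?thesis .
qed

text \<open>Counterpart of \<open>tm_log_split_sums\<close> with 2 factored out of every logarithm:
  two copies of \<open>ln 2\<close> enter with each sign and cancel, provided no argument is
  0.\<close>

lemma tm_log_split_sums':
  "(\<lambda>n. tm_sign n * (ln (real n + a / 2) - ln (real n + 1 / 2)
      - ln (real n + (a + 1) / 2) + ln (real n + 1))) sums
    (tm_log (a / 2) - tm_log (1 / 2) - tm_log ((a + 1) / 2))"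
  using sums_diff[OF tm_log_diff_sums[of "a / 2" "1 / 2"]
      tm_log_diff_sums[of "(a + 1) / 2" 1]]
  by (simp add: algebra_simps tm_log_1)

text \<open>At \<open>a = 0\<close> the summands of the two splittings differ only for \<open>n = 0\<close>, where
  \<open>ln 0 = 0\<close> violates \<open>ln (2 * 0) = ln 2 + ln 0\<close>.\<close>

lemma tm_log_half: "tm_log (1 / 2) = - ln 2 / 2"
proof -
  let ?f = "\<lambda>n. tm_sign n * (ln (2 * real n + 0) - ln (2 * real n + 1)
      - ln (2 * real n + 1 + 0) + ln (2 * real n + 2))"
  let ?g = "\<lambda>n. tm_sign n * (ln (real n + 0 / 2) - ln (real n + 1 / 2)
      - ln (real n + (0 + 1) / 2) + ln (real n + 1))"
  have eq: "?g n - ?f n = (if n = 0 then ln 2 else 0)" for n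
    using ln_double_add[of n 0] ln_double_add[of n 1] ln_double_add[of n 2]
    by (cases "n = 0") (auto simp: tm_sign_0 ln_div)
  have "(\<lambda>n. ?g n - ?f n) sums (tm_log (0 / 2) - tm_log (1 / 2) - tm_log ((0 + 1) / 2) - tm_log 0)"
    by (rule sums_diff[OF tm_log_split_sums' tm_log_split_sums])
  moreover have "(\<lambda>n. ?g n - ?f n) sums ln 2"
    unfolding eq using sums_single[of 0 "\<lambda>_. ln 2 :: real"] by simp
  \<comment> \<open>Here \<open>tm_log (0 / 2)\<close> cancels \<open>tm_log 0\<close>, which leaves
    \<open>- 2 * tm_log (1 / 2) = ln 2\<close>.\<close>
  ultimately show ?thesis
    using sums_unique2 by fastforce
qed

lemma tm_log_split:
  assumes "\<And>n. 2 * real n + a \<noteq> 0" "\<And>n. 2 * real n + 1 + a \<noteq> 0"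
  shows "tm_log (a / 2) - tm_log ((a + 1) / 2) = tm_log a - ln 2 / 2"
proof -
  have "ln (2 * real n + a) - ln (2 * real n + 1) - ln (2 * real n + 1 + a) + ln (2 * real n + 2)
    = ln (real n + a / 2) - ln (real n + 1 / 2) - ln (real n + (a + 1) / 2) + ln (real n + 1)" for n
    using assms[of n] ln_double_add[of n a] ln_double_add[of n 1]
      ln_double_add[of n "1 + a"] ln_double_add[of n 2]
    by (simp add: add.assoc add.commute[of 1 a])
  then have "tm_log a = tm_log (a / 2) - tm_log (1 / 2) - tm_log ((a + 1) / 2)"
    using sums_unique2[OF tm_log_split_sums[of a]] tm_log_split_sums'[of a] by simp
  then show ?thesis
    by (simp add: tm_log_half)
qed

section \<open>From signed series to products\<close>

text \<open>Positivity is required of the quotient rather than of the shifts, so that the negative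
  shifts of (c) are covered; the logarithm still splits because no factor vanishes.\<close>

lemma tm_prod:
  assumes eq: "\<And>n. f n = ((real n + a) * (real n + b)) / ((real n + c) * (real n + d))"
    and pos: "\<And>n. f n > 0"
    and val: "tm_log a + tm_log b - tm_log c - tm_log d = S" and S: "exp S = p"
  shows "raw_has_prod (\<lambda>n. f n powi ((- 1) ^ thue_morse n)) 0 p"
proof -
  have nz: "real n + a \<noteq> 0 \<and> real n + b \<noteq> 0 \<and> real n + c \<noteq> 0 \<and> real n + d \<noteq> 0" for n
    using pos[of n] by (auto simp: eq)
  have "(\<lambda>n. tm_sign n * (ln (real n + a) - ln (real n + c))
      + tm_sign n * (ln (real n + b) - ln (real n + d))) sums
      (tm_log a - tm_log c + (tm_log b - tm_log d))"
    by (intro sums_add tm_log_diff_sums)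
  moreover have "ln (f n) = ln (real n + a) + ln (real n + b) - (ln (real n + c) + ln (real n + d))" for n
    using nz[of n] by (simp add: eq ln_div ln_mult)
  ultimately have "(\<lambda>n. tm_sign n * ln (f n)) sums S"
    by (simp only: flip: val) (simp add: algebra_simps)
  from sums_imp_has_prod_exp[OF this] show ?thesis
    by (simp add: powi_tm_sign[OF pos] S)
qed

corollary tm_has_prod:
  assumes S: "exp S = p"
    and eq: "\<And>n. f n = ((real n + a) * (real n + b)) / ((real n + c) * (real n + d))"
    and abcd: "a > 0" "b > 0" "c > 0" "d > 0"
    and val: "tm_log a + tm_log b - tm_log c - tm_log d = S"
  shows "(\<lambda>n. f n powi ((- 1) ^ thue_morse n)) has_prod p"
proof -
  have "f n > 0" for n
    unfolding eq using abcd by (intro divide_pos_pos mult_pos_pos add_nonneg_pos) auto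
  from tm_prod[OF eq this val S] show ?thesis
    by (simp add: has_prod_def)
qed

lemma exp_ln2: "exp (ln 2 :: real) = 2"
  by simp

lemma exp_minus_ln2: "exp (- ln 2 :: real) = 1 / 2"
  by (simp add: exp_minus)

lemma exp_minus_half_ln2: "exp (- ln 2 / 2 :: real) = sqrt 2 / 2"
proof (rule power2_eq_imp_eq)
  have "exp (- ln 2 / 2 :: real) ^ 2 = exp (- ln 2)"
    by (simp flip: exp_double)
  also have "\<dots> = (sqrt 2 / 2) ^ 2"
    by (simp add: exp_minus power_divide)
  finally show "exp (- ln 2 / 2 :: real) ^ 2 = (sqrt 2 / 2) ^ 2" .
qed auto

lemma exp_minus_three_halves_ln2: "exp (- 3 * ln 2 / 2 :: real) = sqrt 2 / 4"
proof -
  have "exp (- 3 * ln 2 / 2 :: real) = exp (- ln 2) * exp (- ln 2 / 2)"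
    by (simp flip: exp_add)
  then show ?thesis
    unfolding exp_minus_ln2 exp_minus_half_ln2 by simp
qed

lemma exp_minus_two_ln2: "exp (- 2 * ln 2 :: real) = 1 / 4"
proof -
  have "exp (- 2 * ln 2 :: real) = exp (- ln 2) * exp (- ln 2)"
    by (simp flip: exp_add)
  then show ?thesis
    unfolding exp_minus_ln2 by simp
qed

theorem corollary2p4:
  shows "((\<lambda>n. ((2 * real n + 1) / (2 * real n + 2)) powi ((- 1) ^ thue_morse n)) has_prod (sqrt 2 / 2)) \<and>
    ((\<lambda>n. ((4 * real n + 1) / (4 * real n + 3)) powi ((- 1) ^ thue_morse n)) has_prod (1 / 2)) \<and>
    raw_has_prod (\<lambda>n. (((2 * real n - 1) * (4 * real n + 1)) / ((2 * real n + 1) * (4 * real n - 1))) powi ((- 1) ^ thue_morse n)) 1 2 \<and>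
    ((\<lambda>n. (((real n + 1) * (2 * real n + 1)) / ((real n + 2) * (2 * real n + 3))) powi ((- 1) ^ thue_morse n)) has_prod (1 / 2)) \<and>
    ((\<lambda>n. (((2 * real n + 2) * (4 * real n + 3)) / ((2 * real n + 3) * (4 * real n + 5))) powi ((- 1) ^ thue_morse n)) has_prod (sqrt 2 / 2)) \<and>
    ((\<lambda>n. (((real n + 1) * (4 * real n + 5)) / ((real n + 2) * (4 * real n + 3))) powi ((- 1) ^ thue_morse n)) has_prod 1) \<and>
    ((\<lambda>n. (((real n + 1) * (2 * real n + 2)) / ((real n + 2) * (2 * real n + 3))) powi ((- 1) ^ thue_morse n)) has_prod (sqrt 2 / 2)) \<and>
    ((\<lambda>n. (((real n + 1) * (4 * real n + 5)) / ((real n + 2) * (4 * real n + 1))) powi ((- 1) ^ thue_morse n)) has_prod 2) \<and>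
    ((\<lambda>n. (((2 * real n + 2) * (4 * real n + 1)) / ((2 * real n + 3) * (4 * real n + 5))) powi ((- 1) ^ thue_morse n)) has_prod (sqrt 2 / 4)) \<and>
    ((\<lambda>n. (((2 * real n + 1) * (4 * real n + 1)) / ((2 * real n + 3) * (4 * real n + 5))) powi ((- 1) ^ thue_morse n)) has_prod (1 / 4)) \<and>
    ((\<lambda>n. (((4 * real n + 1) * (8 * real n + 7)) / ((4 * real n + 2) * (8 * real n + 3))) powi ((- 1) ^ thue_morse n)) has_prod 1) \<and>
    ((\<lambda>n. (((8 * real n + 1) * (8 * real n + 7)) / ((8 * real n + 3) * (8 * real n + 5))) powi ((- 1) ^ thue_morse n)) has_prod (1 / 2))"
proof -
  have split: "tm_log (a / 2) - tm_log ((a + 1) / 2) = tm_log a - ln 2 / 2" if "a > 0" for a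
    using that by (intro tm_log_split) (smt (verit) of_nat_0_le_iff)+
  \<comment> \<open>The functional equation at \<open>a = - (1 / 2)\<close>, which links the two
    negative shifts of (c).\<close>
  have split_neg: "tm_log (- (1 / 4)) - tm_log (1 / 4) = tm_log (- (1 / 2)) - ln 2 / 2"
  proof -
    have "2 * real n + - (1 / 2) \<noteq> 0" "2 * real n + 1 + - (1 / 2) \<noteq> 0" for n
      by (cases n; simp)+
    from tm_log_split[OF this] show ?thesis by simp
  qed
  \<comment> \<open>The values of \<open>a\<close> are chosen so that \<open>a\<close>,
    \<open>a / 2\<close> and \<open>(a + 1) / 2\<close> run through the shifts occurring in the
    products other than (c).\<close>
  note rel = tm_log_half tm_log_1 split[of "1 / 4", simplified] split[of "1 / 2", simplified]
    split[of "3 / 4", simplified] split[of "3 / 2", simplified] split[of 2, simplified]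
  \<comment> \<open>In (c) the factor at \<open>n = 0\<close> is 1, so the product may as well start there.\<close>
  have c: "raw_has_prod (\<lambda>n. (((2 * real n - 1) * (4 * real n + 1)) /
      ((2 * real n + 1) * (4 * real n - 1))) powi ((- 1) ^ thue_morse n)) 0 2"
  proof (rule tm_prod[of _ "- (1 / 2)" "1 / 4" "1 / 2" "- (1 / 4)" "ln 2"])
    show "((2 * real n - 1) * (4 * real n + 1)) / ((2 * real n + 1) * (4 * real n - 1)) > 0" for n
      \<comment> \<open>At \<open>n = 0\<close> numerator and denominator are both negative; for
        larger \<open>n\<close> all factors are positive.\<close>
      by (cases n) (auto intro!: divide_pos_pos mult_pos_pos)
    show "((2 * real n - 1) * (4 * real n + 1)) / ((2 * real n + 1) * (4 * real n - 1)) =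
        ((real n + - (1 / 2)) * (real n + 1 / 4)) / ((real n + 1 / 2) * (real n + - (1 / 4)))" for n
      by (cases n) (simp_all add: divide_simps, simp add: algebra_simps)
    show "tm_log (- (1 / 2)) + tm_log (1 / 4) - tm_log (1 / 2) - tm_log (- (1 / 4)) = ln 2"
      using split_neg tm_log_half by simp
  qed simp
  show ?thesis
    \<comment> \<open>Each shift is the constant term of a linear factor divided by its leading
      coefficient; the leading coefficients cancel in every quotient. In (a) and (b) a common factor
      \<open>real n + 1\<close> pads the quotient to two factors above and below.\<close>
    apply (intro conjI)
    subgoal by (rule tm_has_prod[OF exp_minus_half_ln2, of _ "1 / 2" 1 1 1])
      ((simp add: divide_simps; simp add: algebra_simps), use rel in simp_all)
    subgoal by (rule tm_has_prod[OF exp_minus_ln2, of _ "1 / 4" 1 "3 / 4" 1])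
      ((simp add: divide_simps; simp add: algebra_simps), use rel in simp_all)
    subgoal using c by (subst (asm) raw_has_prod_Suc_iff') (simp add: raw_has_prod_Suc thue_morse_0)
    subgoal by (rule tm_has_prod[OF exp_minus_ln2, of _ 1 "1 / 2" 2 "3 / 2"])
      ((simp add: divide_simps; simp add: algebra_simps), use rel in simp_all)
    subgoal by (rule tm_has_prod[OF exp_minus_half_ln2, of _ 1 "3 / 4" "3 / 2" "5 / 4"])
      ((simp add: divide_simps; simp add: algebra_simps), use rel in simp_all)
    subgoal by (rule tm_has_prod[OF exp_zero, of _ 1 "5 / 4" 2 "3 / 4"])
      ((simp add: divide_simps; simp add: algebra_simps), use rel in simp_all)
    subgoal by (rule tm_has_prod[OF exp_minus_half_ln2, of _ 1 1 2 "3 / 2"])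
      ((simp add: divide_simps; simp add: algebra_simps), use rel in simp_all)
    subgoal by (rule tm_has_prod[OF exp_ln2, of _ 1 "5 / 4" 2 "1 / 4"])
      ((simp add: divide_simps; simp add: algebra_simps), use rel in simp_all)
    subgoal by (rule tm_has_prod[OF exp_minus_three_halves_ln2, of _ 1 "1 / 4" "3 / 2" "5 / 4"])
      ((simp add: divide_simps; simp add: algebra_simps), use rel in simp_all)
    subgoal by (rule tm_has_prod[OF exp_minus_two_ln2, of _ "1 / 2" "1 / 4" "3 / 2" "5 / 4"])
      ((simp add: divide_simps; simp add: algebra_simps), use rel in simp_all)
    subgoal by (rule tm_has_prod[OF exp_zero, of _ "1 / 4" "7 / 8" "1 / 2" "3 / 8"])
      ((simp add: divide_simps; simp add: algebra_simps), use rel in simp_all)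
    subgoal by (rule tm_has_prod[OF exp_minus_ln2, of _ "1 / 8" "7 / 8" "3 / 8" "5 / 8"])
      ((simp add: divide_simps; simp add: algebra_simps), use rel in simp_all)
    done
qed

end
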